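(* An (unbounded) convex body $X\subset\mathbb{R}^n$ satisfies $e_r(X)=\sigma(X)$ for some $r>0$ and a distance-increasing similarity transformation $\sigma$ if and only if $X$ has an exscribed ball.
   Context: Erosion: for $X\subset\mathbb{R}^n$ and $r>0$, $e_r(X)=X\setminus\bigcup_{y\in X^C}B(r,y)$, where $X^C=\mathbb{R}^n\setminus X$ and $B(r,y)$ is the open ball of radius $r$ about $y$. A similarity transformation is a map $\sigma:\mathbb{R}^n\to\mathbb{R}^n$ for which there is a scaling factor $\alpha>0$ with $|\sigma(x)-\sigma(y)|=\alpha|x-y|$ for all $x,y$; it is distance-increasing if $\alpha>1$. A convex body is a closed convex subset of $\mathbb{R}^n$. A closed half-space $H$ containing the convex body $X$ is a supporting half-space of $X$ at a boundary point $x$ of $X$ if $x$ also lies on the boundary of $H$. A boundary point $x$ of $X$ is regular if it has a unique supporting half-space. A supporting half-space is regular if it is supporting at at least one regular point of $X$. A convex body $X$ has an exscribed ball of radius $\rho$ centered at a point $p$ if all of its regular supporting half-spaces are at distance $\rho$ from $p$ (in particular, $p$ lies outside of all of them, so $\rho>0$). The distance between $X$ and $p$ may be greater than $\rho$.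
   Formalization: The convex body X is assumed to be empty or to have nonempty interior; a nonempty X with empty interior (e.g. a line in the plane) has no regular points, so it has an exscribed ball vacuously, yet its erosions are empty and the equivalence fails. *)

theory Defs
  imports "HOL-Analysis.Analysis"
begin

definition erosion :: "real \<Rightarrow> 'a::euclidean_space set \<Rightarrow> 'a set" where
  "erosion r X = X - (\<Union>y\<in>- X. ball y r)"

definition similarity :: "real \<Rightarrow> ('a::euclidean_space \<Rightarrow> 'a) \<Rightarrow> bool" where
  "similarity \<alpha> \<sigma> \<longleftrightarrow> \<alpha> > 0 \<and> (\<forall>x y. dist (\<sigma> x) (\<sigma> y) = \<alpha> * dist x y)"

definition distance_increasing_similarity :: "('a::euclidean_space \<Rightarrow> 'a) \<Rightarrow> bool" where
  "distance_increasing_similarity \<sigma> \<longleftrightarrow> (\<exists>\<alpha>>1. similarity \<alpha> \<sigma>)"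

(* Neither boundedness nor nonempty interior is part of this notion. Sets such as a point,
   a line or a hyperplane are convex bodies here. *)
definition convex_body :: "'a::euclidean_space set \<Rightarrow> bool" where
  "convex_body X \<longleftrightarrow> closed X \<and> convex X"

definition closed_halfspace :: "'a::euclidean_space set \<Rightarrow> bool" where
  "closed_halfspace H \<longleftrightarrow> (\<exists>a b. a \<noteq> 0 \<and> H = {x. a \<bullet> x \<le> b})"

definition supporting_halfspace_at :: "'a::euclidean_space set \<Rightarrow> 'a \<Rightarrow> 'a set \<Rightarrow> bool" where
  "supporting_halfspace_at X x H \<longleftrightarrow>
     closed_halfspace H \<and> X \<subseteq> H \<and> x \<in> frontier X \<and> x \<in> frontier H"

definition regular_point :: "'a::euclidean_space set \<Rightarrow> 'a \<Rightarrow> bool" where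
  "regular_point X x \<longleftrightarrow> x \<in> frontier X \<and> (\<exists>!H. supporting_halfspace_at X x H)"

definition regular_supporting_halfspace :: "'a::euclidean_space set \<Rightarrow> 'a set \<Rightarrow> bool" where
  "regular_supporting_halfspace X H \<longleftrightarrow>
     (\<exists>x. regular_point X x \<and> supporting_halfspace_at X x H)"

(* A set without regular points, in particular a nonempty closed convex set with empty interior
   (both sides of a hyperplane containing it support it at every point), has exscribed balls vacuously. *)
definition exscribed_ball :: "'a::euclidean_space set \<Rightarrow> 'a \<Rightarrow> real \<Rightarrow> bool" where
  "exscribed_ball X p \<rho> \<longleftrightarrow>
     \<rho> > 0 \<and> (\<forall>H. regular_supporting_halfspace X H \<longrightarrow> infdist p H = \<rho>)"

definition has_exscribed_ball :: "'a::euclidean_space set \<Rightarrow> bool" where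
  "has_exscribed_ball X \<longleftrightarrow> (\<exists>p \<rho>. exscribed_ball X p \<rho>)"

end

theory Submission
  imports Defs
begin

text \<open>
  Both directions rest on how balls inside a closed convex set X touch its frontier. If a ball
  contained in X with center c touches the frontier at y, then every half-space supporting X at y
  also supports the ball there, so it has the normal y - c and y is regular
  (\<open>touching_ball_regular_normal\<close>). Moving balls until they touch therefore produces regular
  points, and enough of them to write a set with nonempty interior as the intersection of its
  regular supporting half-spaces (\<open>regular_halfspace_separates\<close>).

  Suppose that all regular supporting half-spaces are at distance \<open>\<rho>\<close> from p. With p as origin they
  are the sets where \<open>a \<bullet> x \<le> - \<rho>\<close> for the regular unit normals a. Erosion by \<open>\<rho>\<close> intersects the
  half-spaces \<open>a \<bullet> x \<le> - 2 * \<rho>\<close>, and that intersection is X dilated by 2 about p.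

  Conversely, let the erosion of X by r be the image of X under a similarity \<open>\<sigma>\<close> of factor
  \<open>\<alpha> > 1\<close>. Such a map has a fixed point p; take it as origin, so that \<open>\<sigma> x = \<alpha> T x\<close> with T orthogonal.
  If y is a regular point with normal a, then the ball of radius r about \<open>\<sigma> y\<close> touches the frontier
  of X, and regularity of y forces it to touch at \<open>\<sigma> y + r T a\<close>, a regular point with normal
  \<open>T a\<close> (\<open>regular_normal_step\<close>). Put \<open>c = r / (\<alpha> - 1)\<close> and \<open>z = y + c a\<close>. Since
  \<open>r + c = \<alpha> c\<close>, iteration gives regular points \<open>Y\<^sub>k = \<alpha>\<^sup>k T\<^sup>k z - c A\<^sub>k\<close> with normals
  \<open>A\<^sub>k = T\<^sup>k a\<close>. These points must all satisfy one another's supporting inequalities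
  \<open>A\<^sub>m \<bullet> Y\<^sub>k \<le> A\<^sub>m \<bullet> Y\<^sub>m\<close>, while \<open>A\<^sub>k \<bullet> Y\<^sub>k = \<alpha>\<^sup>k (a \<bullet> z) - c\<close> grows exponentially in absolute value unless
  \<open>a \<bullet> z = 0\<close>. The inequalities for Y at index 0 exclude \<open>a \<bullet> z < 0\<close>. For the other sign, a limit w
  of a subsequence of \<open>T\<^sup>k z\<close> is a direction of recession of X, so \<open>A\<^sub>m \<bullet> w \<le> 0\<close> for all m, and
  letting m run through the subsequence gives \<open>a \<bullet> z \<le> 0\<close>. Hence \<open>a \<bullet> y = - c\<close> for every regular
  point y with normal a: the number c is the radius of an exscribed ball about p
  (\<open>regular_normal_height\<close>).
\<close>

section \<open>Half-spaces with unit normals\<close>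

lemma ball_subset_halfspace_iff:
  fixes a :: "'a::euclidean_space"
  assumes "norm a = 1" "r > 0"
  shows "ball c r \<subseteq> {w. a \<bullet> w \<le> b} \<longleftrightarrow> a \<bullet> c + r \<le> b"
proof
  assume "ball c r \<subseteq> {w. a \<bullet> w \<le> b}"
  then have "closure (ball c r) \<subseteq> {w. a \<bullet> w \<le> b}"
    by (rule closure_minimal) (rule closed_halfspace_le)
  moreover have "c + r *\<^sub>R a \<in> closure (ball c r)"
    using assms by (simp add: dist_norm)
  ultimately have "a \<bullet> (c + r *\<^sub>R a) \<le> b" by blast
  moreover have "a \<bullet> a = 1" using assms(1) by (simp add: norm_eq_1)
  ultimately show "a \<bullet> c + r \<le> b" by (simp add: inner_add_right)
next
  assume b: "a \<bullet> c + r \<le> b"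
  show "ball c r \<subseteq> {w. a \<bullet> w \<le> b}"
  proof
    fix w assume "w \<in> ball c r"
    then have "a \<bullet> (w - c) \<le> r"
      using norm_cauchy_schwarz[of a "w - c"] assms(1)
      by (simp add: dist_norm norm_minus_commute)
    with b show "w \<in> {w. a \<bullet> w \<le> b}" by (simp add: inner_diff_right)
  qed
qed

lemma infdist_halfspace:
  fixes a :: "'a::euclidean_space"
  assumes a: "norm a = 1"
  shows "infdist p {w. a \<bullet> w \<le> b} = max 0 (a \<bullet> p - b)"
proof (cases "a \<bullet> p \<le> b")
  case True
  then show ?thesis by simp
next
  case False
  let ?H = "{w. a \<bullet> w \<le> b}"
  define q where "q = p - (a \<bullet> p - b) *\<^sub>R a"
  have aa: "a \<bullet> a = 1" using a by (simp add: norm_eq_1)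
  have q: "q \<in> ?H" by (simp add: q_def inner_diff_right aa)
  have "infdist p ?H \<le> a \<bullet> p - b"
    using infdist_le[OF q, of p] False a by (simp add: q_def dist_norm)
  moreover have "a \<bullet> p - b \<le> infdist p ?H"
    unfolding infdist_def using q
  proof (auto intro!: cINF_greatest)
    fix w assume "a \<bullet> w \<le> b"
    then show "a \<bullet> p - b \<le> dist p w"
      using norm_cauchy_schwarz[of a "p - w"] a by (simp add: dist_norm inner_diff_right)
  qed
  ultimately show ?thesis using False by simp
qed

text \<open>
  The unit ball about \<open>y - u\<close> touches the half-space at y from inside; as it also lies in the
  half-space with normal v, it gives \<open>u \<bullet> v \<ge> 1\<close>, the equality case of Cauchy-Schwarz.
\<close>
lemma halfspace_unit_normal_unique:
  fixes u v y :: "'a::euclidean_space"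
  assumes u: "norm u = 1" and v: "norm v = 1"
    and eq: "{w. u \<bullet> w \<le> u \<bullet> y} = {w. v \<bullet> w \<le> v \<bullet> y}"
  shows "u = v"
proof -
  have uu: "u \<bullet> u = 1" "v \<bullet> v = 1" using u v by (simp_all add: norm_eq_1)
  have "ball (y - u) 1 \<subseteq> {w. v \<bullet> w \<le> v \<bullet> y}"
    unfolding eq[symmetric] using u uu by (subst ball_subset_halfspace_iff) (auto simp: inner_diff_right)
  then have "v \<bullet> u \<ge> 1"
    using v by (subst (asm) ball_subset_halfspace_iff) (auto simp: inner_diff_right)
  then have "(u - v) \<bullet> (u - v) \<le> 0"
    using uu by (simp add: inner_diff_left inner_diff_right inner_commute)
  then show ?thesis by (metis inner_ge_zero order_antisym inner_eq_zero_iff right_minus_eq)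
qed

section \<open>Regular points and their normals\<close>

text \<open>
  Regularity expressed through outward unit normals: unlike the half-spaces themselves, normals can
  be moved by an orthogonal map and passed to a limit.
\<close>
definition regular_normal :: "'a::euclidean_space set \<Rightarrow> 'a \<Rightarrow> 'a \<Rightarrow> bool" where
  "regular_normal X y a \<longleftrightarrow> norm a = 1 \<and> y \<in> frontier X \<and> X \<subseteq> {w. a \<bullet> w \<le> a \<bullet> y} \<and>
     (\<forall>v. norm v = 1 \<and> X \<subseteq> {w. v \<bullet> w \<le> v \<bullet> y} \<longrightarrow> v = a)"

lemma supporting_halfspace_at_iff:
  "supporting_halfspace_at X y H \<longleftrightarrow>
     y \<in> frontier X \<and> (\<exists>v. norm v = 1 \<and> H = {w. v \<bullet> w \<le> v \<bullet> y} \<and> X \<subseteq> H)"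
proof
  assume "supporting_halfspace_at X y H"
  then obtain a b where a: "a \<noteq> 0" "H = {x. a \<bullet> x \<le> b}"
    and H: "X \<subseteq> H" "y \<in> frontier X" "y \<in> frontier H"
    unfolding supporting_halfspace_at_def closed_halfspace_def by blast
  have b: "b = a \<bullet> y" using H(3) a frontier_halfspace_le[of a b] by simp
  define v where "v = (1 / norm a) *\<^sub>R a"
  have "norm v = 1" using a by (simp add: v_def)
  moreover have "H = {w. v \<bullet> w \<le> v \<bullet> y}"
    using a by (simp add: v_def b divide_right_mono divide_le_cancel)
  ultimately show "y \<in> frontier X \<and> (\<exists>v. norm v = 1 \<and> H = {w. v \<bullet> w \<le> v \<bullet> y} \<and> X \<subseteq> H)"
    using H by blast
next
  assume "y \<in> frontier X \<and> (\<exists>v. norm v = 1 \<and> H = {w. v \<bullet> w \<le> v \<bullet> y} \<and> X \<subseteq> H)"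
  then obtain v where v: "y \<in> frontier X" "norm v = 1" "H = {w. v \<bullet> w \<le> v \<bullet> y}" "X \<subseteq> H"
    by blast
  then have "v \<noteq> 0" by auto
  then show "supporting_halfspace_at X y H"
    using v frontier_halfspace_le[of v "v \<bullet> y"]
    unfolding supporting_halfspace_at_def closed_halfspace_def by auto
qed

lemma regular_supporting_halfspace_iff:
  "regular_supporting_halfspace X H \<longleftrightarrow> (\<exists>y a. regular_normal X y a \<and> H = {w. a \<bullet> w \<le> a \<bullet> y})"
proof
  assume "regular_supporting_halfspace X H"
  then obtain y where y: "regular_point X y" "supporting_halfspace_at X y H"
    unfolding regular_supporting_halfspace_def by blast
  then obtain a where a: "norm a = 1" "H = {w. a \<bullet> w \<le> a \<bullet> y}" "X \<subseteq> H" "y \<in> frontier X"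
    unfolding supporting_halfspace_at_iff by blast
  have "v = a" if v: "norm v = 1" "X \<subseteq> {w. v \<bullet> w \<le> v \<bullet> y}" for v
  proof -
    have "supporting_halfspace_at X y {w. v \<bullet> w \<le> v \<bullet> y}"
      unfolding supporting_halfspace_at_iff using v a by blast
    then have "{w. v \<bullet> w \<le> v \<bullet> y} = H" using y unfolding regular_point_def by blast
    then show ?thesis using halfspace_unit_normal_unique v a by blast
  qed
  then have "regular_normal X y a" using a unfolding regular_normal_def by blast
  then show "\<exists>y a. regular_normal X y a \<and> H = {w. a \<bullet> w \<le> a \<bullet> y}" using a by blast
next
  assume "\<exists>y a. regular_normal X y a \<and> H = {w. a \<bullet> w \<le> a \<bullet> y}"
  then obtain y a where a: "regular_normal X y a" "H = {w. a \<bullet> w \<le> a \<bullet> y}" by blast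
  then have H: "supporting_halfspace_at X y H"
    unfolding supporting_halfspace_at_iff regular_normal_def by blast
  moreover have "K = H" if "supporting_halfspace_at X y K" for K
    using that a unfolding supporting_halfspace_at_iff regular_normal_def by blast
  ultimately have "regular_point X y"
    unfolding regular_point_def using a(1)[unfolded regular_normal_def] by blast
  then show "regular_supporting_halfspace X H"
    unfolding regular_supporting_halfspace_def using H by blast
qed

text \<open>
  A positive distance to a half-space is the signed height of p above its bounding hyperplane, so
  the geometric definition becomes a family of linear equations.
\<close>
lemma exscribed_ball_iff:
  "exscribed_ball X p \<rho> \<longleftrightarrow> \<rho> > 0 \<and> (\<forall>y a. regular_normal X y a \<longrightarrow> a \<bullet> (p - y) = \<rho>)"
proof -
  have "infdist p {w. a \<bullet> w \<le> a \<bullet> y} = \<rho> \<longleftrightarrow> a \<bullet> (p - y) = \<rho>"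
    if "regular_normal X y a" "\<rho> > 0" for y a
    using that infdist_halfspace[of a p "a \<bullet> y"]
    by (auto simp: regular_normal_def inner_diff_right max_def)
  then show ?thesis
    unfolding exscribed_ball_def regular_supporting_halfspace_iff by blast
qed

text \<open>
  A half-space that supports X at y contains the ball and has y on its boundary, which leaves only
  the direction from the center to y for its normal; some half-space does support X at y because X
  is convex.
\<close>
lemma touching_ball_regular_normal:
  fixes X :: "'a::euclidean_space set"
  assumes "convex X" "ball c r \<subseteq> X" "y \<in> frontier X" "dist c y = r" "r > 0"
  shows "regular_normal X y ((1 / r) *\<^sub>R (y - c))"
proof -
  define n where "n = (1 / r) *\<^sub>R (y - c)"
  have yc: "y - c = r *\<^sub>R n" using assms(5) by (simp add: n_def)
  have "norm (y - c) = r" using assms(4) by (metis dist_norm dist_commute)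
  then have n: "norm n = 1" using assms(5) by (simp add: n_def)
  have unique: "v = n" if v: "norm v = 1" "X \<subseteq> {w. v \<bullet> w \<le> v \<bullet> y}" for v
  proof -
    have "ball c r \<subseteq> {w. v \<bullet> w \<le> v \<bullet> y}" using v assms by blast
    then have "r \<le> v \<bullet> (y - c)"
      using ball_subset_halfspace_iff[OF v(1) \<open>r > 0\<close>] by (simp add: inner_diff_right)
    then have "1 \<le> v \<bullet> n" using \<open>r > 0\<close> by (simp add: yc)
    moreover have "n \<bullet> n = 1" "v \<bullet> v = 1" using n v by (simp_all add: norm_eq_1)
    ultimately have "(v - n) \<bullet> (v - n) \<le> 0"
      by (simp add: inner_diff_left inner_diff_right inner_commute)
    then show ?thesis by (metis inner_ge_zero order_antisym inner_eq_zero_iff right_minus_eq)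
  qed
  have "c \<in> interior X" using assms by (meson centre_in_ball interior_maximal open_ball subsetD)
  then have "rel_interior X = interior X" using rel_interior_nonempty_interior by blast
  then have "y \<in> closure X" "y \<notin> rel_interior X" using assms(3) by (auto simp: frontier_def)
  then obtain a where a: "a \<noteq> 0" "\<And>w. w \<in> closure X \<Longrightarrow> a \<bullet> y \<le> a \<bullet> w"
    using supporting_hyperplane_relative_frontier[OF assms(1)] by metis
  define u where "u = (- 1 / norm a) *\<^sub>R a"
  have u: "norm u = 1" using a by (simp add: u_def)
  moreover have "X \<subseteq> {w. u \<bullet> w \<le> u \<bullet> y}"
    using a closure_subset[of X] by (auto simp: u_def divide_right_mono)
  ultimately have "X \<subseteq> {w. n \<bullet> w \<le> n \<bullet> y}" using unique by metis
  then show ?thesis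
    unfolding regular_normal_def n_def[symmetric] using n unique assms(3) by blast
qed

lemma ball_subset_iff_le_infdist:
  assumes "X \<noteq> UNIV"
  shows "ball c r \<subseteq> X \<longleftrightarrow> r \<le> infdist c (- X)"
proof
  have M: "- X \<noteq> {}" using assms by auto
  assume "ball c r \<subseteq> X"
  then have "r \<le> dist c w" if "w \<in> - X" for w
    using that by (meson ComplD mem_ball not_less subsetD)
  then show "r \<le> infdist c (- X)"
    unfolding infdist_notempty[OF M] using M by (intro cINF_greatest)
next
  assume r: "r \<le> infdist c (- X)"
  show "ball c r \<subseteq> X"
  proof
    fix w assume "w \<in> ball c r"
    then have "\<not> infdist c (- X) \<le> dist c w" using r by simp
    then show "w \<in> X" using infdist_le[of w "- X" c] by blast
  qed
qed

lemma largest_ball_touches_frontier: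
  fixes X :: "'a::euclidean_space set"
  assumes "X \<noteq> UNIV" and r: "infdist c (- X) = r" "r > 0"
  obtains y where "ball c r \<subseteq> X" "y \<in> frontier X" "dist c y = r"
proof -
  have "closure (- X) \<noteq> {}" using assms(1) by auto
  then obtain y where y: "y \<in> closure (- X)" "infdist c (closure (- X)) = dist c y"
    using infdist_attains_inf[of "closure (- X)" c] by auto
  moreover have "infdist c (closure (- X)) = infdist c (- X)"
    by (simp add: infdist_eq_setdist)
  ultimately have d: "dist c y = r" using r by simp
  have sub: "ball c r \<subseteq> X" using ball_subset_iff_le_infdist[OF assms(1)] r by simp
  have "y \<in> closure (ball c r)" using d r by simp
  then have "y \<in> closure X" using closure_mono[OF sub] by blast
  then have "y \<in> frontier X" using y by (simp add: frontier_closures)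
  then show ?thesis using that sub d by simp
qed

text \<open>
  Move from an interior point q towards x and let the radius of the moving ball shrink linearly, so
  that it reaches 0 exactly at x. The ball is inside X at first and not inside at the end, so at some
  position it fits exactly and touches the frontier. In the cone formed by the moving balls, a
  half-space that touches the ball at that position and contains a larger initial ball about q
  cannot contain the apex x. Shrinking from half of the available radius e, and not from e, makes
  the initial ball strictly larger, hence the separation strict.
\<close>
lemma regular_halfspace_separates:
  fixes X :: "'a::euclidean_space set"
  assumes "closed X" "convex X" "interior X \<noteq> {}" "x \<notin> X"
  obtains y a where "regular_normal X y a" "a \<bullet> y < a \<bullet> x"
proof -
  have U: "X \<noteq> UNIV" using assms(4) by auto
  obtain q e where e: "e > 0" "ball q e \<subseteq> X"
    using assms(3) by (auto simp: mem_interior)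
  define c where "c t = q + t *\<^sub>R (x - q)" for t :: real
  define f where "f t = infdist (c t) (- X) - (1 - t) * (e / 2)" for t
  have cont: "continuous_on S f" for S
    unfolding f_def c_def by (intro continuous_intros)
  obtain d where d: "d > 0" "ball x d \<subseteq> - X"
    using assms(1,4) by (metis ComplI open_Compl openE)
  \<comment> \<open>at parameter 1 the radius and possibly f vanish, so the sign change needs an earlier point outside X\<close>
  obtain t1 where t1: "0 < t1" "t1 < 1" "c t1 \<notin> X"
  proof -
    have "x \<noteq> q" using assms(4) e centre_in_ball by blast
    define s where "s = min (1/2) (d / (2 * norm (x - q)))"
    have s: "0 < s" "s \<le> 1/2" "s * norm (x - q) < d"
    proof -
      show "0 < s" using d \<open>x \<noteq> q\<close> by (simp add: s_def)
      show "s \<le> 1/2" by (simp add: s_def)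
      have "s * norm (x - q) \<le> d / (2 * norm (x - q)) * norm (x - q)"
        by (intro mult_right_mono) (auto simp: s_def)
      also have "\<dots> < d" using d \<open>x \<noteq> q\<close> by simp
      finally show "s * norm (x - q) < d" .
    qed
    have "x - c (1 - s) = s *\<^sub>R (x - q)" by (simp add: c_def algebra_simps)
    then have "dist x (c (1 - s)) < d" using s by (simp add: dist_norm)
    then have "c (1 - s) \<notin> X" using d by auto
    then show ?thesis using that[of "1 - s"] s by auto
  qed
  have "f t1 < 0"
  proof -
    have "c t1 \<in> - X" using t1 by blast
    then show ?thesis using t1 e by (simp add: f_def)
  qed
  moreover have "f 0 \<ge> 0"
    using e ball_subset_iff_le_infdist[OF U, of q e] by (simp add: f_def c_def)
  ultimately obtain t where t: "0 \<le> t" "t \<le> t1" "f t = 0"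
    using IVT2'[of f t1 0 0] cont t1 by auto
  define r where "r = (1 - t) * (e / 2)"
  have r: "r > 0" "infdist (c t) (- X) = r" using t t1 e by (auto simp: r_def f_def)
  obtain y where y: "ball (c t) r \<subseteq> X" "y \<in> frontier X" "dist (c t) y = r"
    using largest_ball_touches_frontier[OF U r(2,1)] by metis
  define a where "a = (1 / r) *\<^sub>R (y - c t)"
  have a: "regular_normal X y a"
    unfolding a_def using touching_ball_regular_normal assms(2) y r(1) by blast
  have na: "norm a = 1" and sub: "X \<subseteq> {w. a \<bullet> w \<le> a \<bullet> y}"
    using a by (auto simp: regular_normal_def)
  have "y - c t = r *\<^sub>R a" using r by (simp add: a_def)
  then have "a \<bullet> y = a \<bullet> c t + r"
    using na by (metis inner_scaleR_right inner_diff_right norm_eq_1 mult.right_neutral add.commute diff_eq_eq)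
  then have ay: "a \<bullet> y = a \<bullet> q + t * (a \<bullet> (x - q)) + r"
    by (simp add: c_def inner_add_right)
  have "a \<bullet> q + e \<le> a \<bullet> y"
    using ball_subset_halfspace_iff[OF na e(1)] sub e(2) by blast
  then have "e \<le> t * (a \<bullet> (x - q)) + r" unfolding ay by simp
  then have "e / 2 \<le> t * (a \<bullet> (x - q) - e / 2)" by (simp add: r_def field_simps)
  then have "0 < t * (a \<bullet> (x - q) - e / 2)" using e by linarith
  then have "e / 2 < a \<bullet> (x - q)" using t by (simp add: zero_less_mult_iff)
  then have "r < (1 - t) * (a \<bullet> (x - q))"
    unfolding r_def using t t1 by (intro mult_strict_left_mono) auto
  moreover have "t * (a \<bullet> (x - q)) + (1 - t) * (a \<bullet> (x - q)) = a \<bullet> (x - q)"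
    by (simp flip: distrib_right)
  ultimately have "a \<bullet> y < a \<bullet> q + a \<bullet> (x - q)" unfolding ay by linarith
  then have "a \<bullet> y < a \<bullet> x" by (simp add: inner_diff_right)
  then show ?thesis using that a by blast
qed

section \<open>Erosion\<close>

lemma erosion_iff:
  assumes "r > 0"
  shows "x \<in> erosion r X \<longleftrightarrow> ball x r \<subseteq> X"
proof -
  have "x \<in> ball x r" using assms by simp
  then show ?thesis unfolding erosion_def by (auto simp: dist_commute subset_iff)
qed

text \<open>
  The radius \<open>\<rho>\<close> doubles the height of p above each regular supporting half-space; any other
  positive radius would dilate by another factor greater than 1.
\<close>
lemma exscribed_ball_imp_erosion_homothetic:
  fixes X :: "'a::euclidean_space set"
  assumes "closed X" "convex X" "interior X \<noteq> {}" and ex: "exscribed_ball X p \<rho>"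
  shows "erosion \<rho> X = (\<lambda>x. p + 2 *\<^sub>R (x - p)) ` X"
proof -
  have \<rho>: "\<rho> > 0" and D: "\<And>y a. regular_normal X y a \<Longrightarrow> a \<bullet> (p - y) = \<rho>"
    using ex by (auto simp: exscribed_ball_iff)
  \<comment> \<open>X is the intersection of its regular supporting half-spaces, stated so that it applies to
    points as well as to balls\<close>
  have X: "S \<subseteq> X \<longleftrightarrow> (\<forall>y a. regular_normal X y a \<longrightarrow> S \<subseteq> {w. a \<bullet> w \<le> a \<bullet> y})" for S
  proof
    assume "S \<subseteq> X"
    then show "\<forall>y a. regular_normal X y a \<longrightarrow> S \<subseteq> {w. a \<bullet> w \<le> a \<bullet> y}"
      unfolding regular_normal_def by blast
  next
    assume S: "\<forall>y a. regular_normal X y a \<longrightarrow> S \<subseteq> {w. a \<bullet> w \<le> a \<bullet> y}"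
    show "S \<subseteq> X"
    proof
      fix x assume "x \<in> S"
      show "x \<in> X"
      proof (rule ccontr)
        assume "x \<notin> X"
        then obtain y a where "regular_normal X y a" "a \<bullet> y < a \<bullet> x"
          using regular_halfspace_separates assms by metis
        then show False using S \<open>x \<in> S\<close> by fastforce
      qed
    qed
  qed
  have main: "p + 2 *\<^sub>R (x - p) \<in> erosion \<rho> X \<longleftrightarrow> x \<in> X" for x
  proof -
    have eq: "ball (p + 2 *\<^sub>R (x - p)) \<rho> \<subseteq> {w. a \<bullet> w \<le> a \<bullet> y} \<longleftrightarrow> {x} \<subseteq> {w. a \<bullet> w \<le> a \<bullet> y}"
      if a: "regular_normal X y a" for y a
    proof -
      have "norm a = 1" using a by (simp add: regular_normal_def)
      then have "ball (p + 2 *\<^sub>R (x - p)) \<rho> \<subseteq> {w. a \<bullet> w \<le> a \<bullet> y} \<longleftrightarrow>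
          a \<bullet> (p + 2 *\<^sub>R (x - p)) + \<rho> \<le> a \<bullet> y"
        using \<rho> by (rule ball_subset_halfspace_iff)
      also have "\<dots> \<longleftrightarrow> a \<bullet> x \<le> a \<bullet> y"
        using D[OF a] by (simp add: inner_add_right inner_diff_right) linarith
      finally show ?thesis by simp
    qed
    have "p + 2 *\<^sub>R (x - p) \<in> erosion \<rho> X \<longleftrightarrow> {x} \<subseteq> X"
      unfolding erosion_iff[OF \<rho>] X using eq by blast
    then show ?thesis by simp
  qed
  show ?thesis
  proof (intro equalityI subsetI)
    fix z assume "z \<in> erosion \<rho> X"
    moreover have z: "z = p + 2 *\<^sub>R ((p + (1/2) *\<^sub>R (z - p)) - p)" by simp
    ultimately have "p + (1/2) *\<^sub>R (z - p) \<in> X" using main by metis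
    then show "z \<in> (\<lambda>x. p + 2 *\<^sub>R (x - p)) ` X" using z by blast
  qed (use main in auto)
qed

section \<open>Increasing similarities\<close>

text \<open>
  After subtracting its value at 0, the similarity is linear. Its linear part L lengthens every
  nonzero vector, so \<open>x - L x\<close> is injective and thereby surjective in finite dimension; this
  solves the fixed point equation.
\<close>
lemma distance_increasing_similarity_fixpoint_form:
  fixes \<sigma> :: "'a::euclidean_space \<Rightarrow> 'a"
  assumes "similarity \<alpha> \<sigma>" "\<alpha> > 1"
  obtains p T where "orthogonal_transformation T" "\<And>x. \<sigma> x = p + \<alpha> *\<^sub>R T (x - p)"
proof -
  have d: "\<And>x y. dist (\<sigma> x) (\<sigma> y) = \<alpha> * dist x y" using assms by (simp add: similarity_def)
  define L where "L x = \<sigma> x - \<sigma> 0" for x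
  have dL: "dist (L x) (L y) = \<alpha> * dist x y" for x y
    using d[of x y] by (simp add: L_def dist_norm)
  have L: "linear L"
    by (rule scaling_linear[where c = \<alpha>]) (use dL in \<open>auto simp: L_def\<close>)
  have nL: "norm (L x) = \<alpha> * norm x" for x
    using dL[of x 0] by (simp add: L_def)
  define T where "T x = (1 / \<alpha>) *\<^sub>R L x" for x
  have "linear T" unfolding T_def by (rule linear_compose_scale_right[OF L])
  moreover have "norm (T x) = norm x" for x
    using nL[of x] assms by (simp add: T_def)
  ultimately have T: "orthogonal_transformation T"
    by (simp add: orthogonal_transformation)
  define N where "N x = x - L x" for x
  have "linear N" unfolding N_def by (intro linear_compose_sub linear_ident L)
  moreover have "inj N"
  proof (subst linear_injective_0[OF \<open>linear N\<close>], intro allI impI)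
    fix x assume "N x = 0"
    then have "norm x = \<alpha> * norm x" using nL[of x] by (simp add: N_def)
    then show "x = 0" using assms by simp
  qed
  ultimately have "surj N" by (simp add: linear_injective_imp_surjective)
  then obtain p where "\<sigma> 0 = N p" by (metis surjD)
  then have p: "\<sigma> 0 = p - L p" by (simp add: N_def)
  have "\<sigma> x = p + \<alpha> *\<^sub>R T (x - p)" for x
  proof -
    have "\<alpha> *\<^sub>R T (x - p) = L x - L p" using assms by (simp add: T_def linear_diff[OF L])
    moreover have "\<sigma> x = L x + \<sigma> 0" by (simp add: L_def)
    ultimately show ?thesis using p by simp
  qed
  then show ?thesis using that T by blast
qed

text \<open>
  The point \<open>\<sigma> y\<close> lies on the frontier of the erosion, so the ball of radius r about it touches
  the frontier of X at some z. The supporting half-space of X at z, moved inwards by r, supports the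
  erosion at \<open>\<sigma> y\<close>. Pulled back by \<open>\<sigma>\<close> it supports X at y, where regularity identifies its normal
  with a. Thus the normal at z is \<open>T a\<close>, which also determines z.
\<close>
lemma regular_normal_step:
  fixes X :: "'a::euclidean_space set"
  assumes "closed X" "convex X" "r > 0" "\<alpha> > 0"
    and T: "orthogonal_transformation T"
    and \<sigma>: "\<And>x. \<sigma> x = p + \<alpha> *\<^sub>R T (x - p)"
    and er: "erosion r X = \<sigma> ` X"
    and a: "regular_normal X y a"
  shows "regular_normal X (\<sigma> y + r *\<^sub>R T a) (T a)"
proof -
  have lT: "linear T" using T by (rule orthogonal_transformation_linear)
  have iT: "T u \<bullet> T v = u \<bullet> v" for u v using T by (simp add: orthogonal_transformation_def)
  have y: "y \<in> frontier X" "y \<in> X"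
    using a \<open>closed X\<close> by (auto simp: regular_normal_def frontier_def)
  have U: "X \<noteq> UNIV" using y by auto
  have B: "ball (\<sigma> y) r \<subseteq> X"
    using y er erosion_iff[OF \<open>r > 0\<close>, of "\<sigma> y"] by blast
  have "infdist (\<sigma> y) (- X) = r"
  proof (rule antisym)
    show "r \<le> infdist (\<sigma> y) (- X)" using B ball_subset_iff_le_infdist[OF U] by blast
    \<comment> \<open>with room to spare, the erosion would contain a neighborhood of \<open>\<sigma> y\<close>, and y would be
      an interior point of X\<close>
    show "infdist (\<sigma> y) (- X) \<le> r"
    proof (rule ccontr)
      define d where "d = infdist (\<sigma> y) (- X) - r"
      assume "\<not> ?thesis"
      then have d: "d > 0" by (simp add: d_def)
      have "ball y (d / \<alpha>) \<subseteq> X"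
      proof
        fix w assume "w \<in> ball y (d / \<alpha>)"
        then have "\<alpha> * norm (w - y) < d"
          using \<open>\<alpha> > 0\<close> by (simp add: dist_norm norm_minus_commute field_simps)
        moreover have "\<sigma> w - \<sigma> y = \<alpha> *\<^sub>R T (w - y)"
        proof -
          have "w - y = (w - p) - (y - p)" by simp
          then have "T (w - y) = T (w - p) - T (y - p)" using linear_diff[OF lT] by metis
          then show ?thesis by (simp add: \<sigma> scaleR_diff_right)
        qed
        ultimately have wy: "dist (\<sigma> w) (\<sigma> y) < d"
          using \<open>\<alpha> > 0\<close> T by (simp add: dist_norm orthogonal_transformation)
        have "ball (\<sigma> w) r \<subseteq> X"
        proof
          fix v assume "v \<in> ball (\<sigma> w) r"
          then have "dist (\<sigma> y) v < infdist (\<sigma> y) (- X)"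
            using wy dist_triangle[of "\<sigma> y" v "\<sigma> w"] by (simp add: d_def dist_commute)
          then show "v \<in> X" using infdist_le[of v "- X" "\<sigma> y"] by fastforce
        qed
        then have "\<sigma> w \<in> \<sigma> ` X" using er erosion_iff[OF \<open>r > 0\<close>] by blast
        moreover have "inj \<sigma>"
        proof (rule injI)
          fix u v assume "\<sigma> u = \<sigma> v"
          then have "T (u - p) = T (v - p)" using \<open>\<alpha> > 0\<close> by (simp add: \<sigma>)
          then have "u - p = v - p" by (rule injD[OF orthogonal_transformation_inj[OF T]])
          then show "u = v" by simp
        qed
        ultimately show "w \<in> X" by (metis imageE injD)
      qed
      then have "y \<in> interior X"
        using d \<open>\<alpha> > 0\<close> by (meson divide_pos_pos mem_interior)
      then show False using y by (simp add: frontier_def)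
    qed
  qed
  then obtain z where z: "z \<in> frontier X" "dist (\<sigma> y) z = r"
    using largest_ball_touches_frontier[OF U _ \<open>r > 0\<close>] by metis
  define n where "n = (1 / r) *\<^sub>R (z - \<sigma> y)"
  have zn: "z = \<sigma> y + r *\<^sub>R n" using \<open>r > 0\<close> by (simp add: n_def)
  have n: "regular_normal X z n"
    unfolding n_def using touching_ball_regular_normal[OF \<open>convex X\<close> B z \<open>r > 0\<close>] .
  have nn: "norm n = 1" and Xn: "X \<subseteq> {w. n \<bullet> w \<le> n \<bullet> z}" using n by (auto simp: regular_normal_def)
  obtain v where v: "n = T v" using orthogonal_transformation_surj[OF T] by (metis surjD)
  have nv: "norm v = 1" using nn T v by (simp add: orthogonal_transformation)
  have "X \<subseteq> {w. v \<bullet> w \<le> v \<bullet> y}"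
  proof
    fix w assume "w \<in> X"
    then have "ball (\<sigma> w) r \<subseteq> X" using er erosion_iff[OF \<open>r > 0\<close>] by blast
    then have "n \<bullet> \<sigma> w + r \<le> n \<bullet> z"
      using ball_subset_halfspace_iff[OF nn \<open>r > 0\<close>] Xn by blast
    also have "n \<bullet> z = n \<bullet> \<sigma> y + r"
      using nn by (simp add: zn inner_add_right norm_eq_1)
    finally have "n \<bullet> \<sigma> w \<le> n \<bullet> \<sigma> y" by simp
    then have "\<alpha> * (v \<bullet> (w - p)) \<le> \<alpha> * (v \<bullet> (y - p))"
      by (simp add: \<sigma> v inner_add_right iT)
    then show "w \<in> {w. v \<bullet> w \<le> v \<bullet> y}"
      using \<open>\<alpha> > 0\<close> by (simp add: inner_diff_right)
  qed
  then have "v = a" using nv a by (simp add: regular_normal_def)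
  then show ?thesis using n zn v by simp
qed

text \<open>
  The constant \<open>r / (\<alpha> - 1)\<close> is the height \<open>h\<close> fixed by \<open>h \<mapsto> \<alpha> * h - r\<close>, which is how
  one application of \<open>regular_normal_step\<close> changes the height of p above the supporting half-space.
  A different height would be expanded away from it exponentially under iteration.
\<close>
lemma regular_normal_height:
  fixes X :: "'a::euclidean_space set"
  assumes X: "closed X" "convex X" and r: "r > 0" and \<alpha>: "\<alpha> > 1"
    and T: "orthogonal_transformation T"
    and \<sigma>: "\<And>x. \<sigma> x = p + \<alpha> *\<^sub>R T (x - p)"
    and er: "erosion r X = \<sigma> ` X"
    and a: "regular_normal X y a"
  shows "a \<bullet> (p - y) = r / (\<alpha> - 1)"
proof -
  define c where "c = r / (\<alpha> - 1)"
  have c: "r + c = \<alpha> * c" using \<alpha> by (simp add: c_def field_simps)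
  define z where "z = y - p + c *\<^sub>R a"
  define A where "A k = (T ^^ k) a" for k
  define Z where "Z k = (T ^^ k) z" for k
  define Y where "Y k = p + \<alpha> ^ k *\<^sub>R Z k - c *\<^sub>R A k" for k
  have lT: "linear T" using T by (rule orthogonal_transformation_linear)
  have nT: "norm (T x) = norm x" for x using T by (simp add: orthogonal_transformation)
  have iT: "T u \<bullet> T v = u \<bullet> v" for u v using T by (simp add: orthogonal_transformation_def)
  have AZ: "A k \<bullet> Z k = a \<bullet> z" for k
    by (induction k) (auto simp: A_def Z_def iT)
  have nZ: "norm (Z k) = norm z" for k
    by (induction k) (auto simp: Z_def nT)
  \<comment> \<open>the iterates of \<open>regular_normal_step\<close> in closed form\<close>
  have reg: "regular_normal X (Y k) (A k)" for k
  proof (induction k)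
    case 0
    then show ?case using a by (simp add: Y_def A_def Z_def z_def)
  next
    case (Suc k)
    have "regular_normal X (\<sigma> (Y k) + r *\<^sub>R T (A k)) (T (A k))"
      using regular_normal_step[OF X r _ T \<sigma> er Suc] \<alpha> by simp
    moreover have "\<sigma> (Y k) + r *\<^sub>R T (A k) = Y (Suc k)"
    proof -
      have "T (Y k - p) = \<alpha> ^ k *\<^sub>R Z (Suc k) - c *\<^sub>R A (Suc k)"
        by (simp add: Y_def linear_diff[OF lT] linear_cmul[OF lT] Z_def A_def)
      moreover have "T (A k) = A (Suc k)" by (simp add: A_def)
      ultimately have "\<sigma> (Y k) + r *\<^sub>R T (A k) =
          p + \<alpha> *\<^sub>R (\<alpha> ^ k *\<^sub>R Z (Suc k) - c *\<^sub>R A (Suc k)) + r *\<^sub>R A (Suc k)"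
        by (simp only: \<sigma>)
      also have "\<dots> = p + \<alpha> ^ Suc k *\<^sub>R Z (Suc k) + (r - \<alpha> * c) *\<^sub>R A (Suc k)"
        by (simp add: scaleR_diff_right scaleR_diff_left)
      also have "r - \<alpha> * c = - c" using c by simp
      finally show ?thesis by (simp add: Y_def)
    qed
    ultimately show ?case by (simp add: A_def)
  qed
  have nA: "norm (A k) = 1" for k using reg[of k] by (simp add: regular_normal_def)
  have AA: "A k \<bullet> A k = 1" for k using nA by (simp add: norm_eq_1)
  have YX: "Y k \<in> X" for k
    using reg[of k] X(1) by (auto simp: regular_normal_def frontier_def)
  have le: "A m \<bullet> Y k \<le> A m \<bullet> Y m" for m k
    using reg[of m] YX[of k] by (auto simp: regular_normal_def)
  have pow0: "(\<lambda>k. K / \<alpha> ^ k) \<longlonglongrightarrow> 0" for K :: real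
    using LIMSEQ_divide_realpow_zero[of \<alpha> K] \<alpha> by simp
  \<comment> \<open>the starting point satisfies all later supporting inequalities\<close>
  have "a \<bullet> z \<ge> 0"
  proof (rule LIMSEQ_le_const2[OF pow0[of "c - norm (y - p)"]])
    have "(c - norm (y - p)) / \<alpha> ^ k \<le> a \<bullet> z" for k
    proof -
      have "Y 0 = y" by (simp add: Y_def A_def Z_def z_def)
      then have "A k \<bullet> y \<le> A k \<bullet> Y k" using le[of k 0] by simp
      also have "A k \<bullet> Y k = A k \<bullet> p + \<alpha> ^ k * (a \<bullet> z) - c"
        by (simp add: Y_def inner_add_right inner_diff_right AA AZ)
      finally have "A k \<bullet> (y - p) + c \<le> \<alpha> ^ k * (a \<bullet> z)" by (simp add: inner_diff_right)
      moreover have "- norm (y - p) \<le> A k \<bullet> (y - p)"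
        using norm_cauchy_schwarz[of "A k" "p - y"] nA[of k] norm_minus_commute[of y p]
        by (simp add: inner_diff_right)
      ultimately show ?thesis using \<alpha> by (simp add: divide_le_eq mult.commute)
    qed
    then show "\<exists>N. \<forall>k\<ge>N. (c - norm (y - p)) / \<alpha> ^ k \<le> a \<bullet> z" by blast
  qed
  \<comment> \<open>the rescaled points accumulate at a direction of recession of X\<close>
  moreover have "a \<bullet> z \<le> 0"
  proof -
    \<comment> \<open>pairs, so that one subsequence serves both limits\<close>
    have "bounded (range (\<lambda>k. (Z k, A k)))"
      unfolding bounded_iff
    proof (intro exI ballI)
      fix q assume "q \<in> range (\<lambda>k. (Z k, A k))"
      then obtain k where "q = (Z k, A k)" by blast
      then show "norm q \<le> norm z + 1"
        using norm_Pair_le[of "Z k" "A k"] nZ nA by simp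
    qed
    then obtain l s where s: "strict_mono s" "((\<lambda>k. (Z k, A k)) \<circ> s) \<longlonglongrightarrow> l"
      using bounded_imp_convergent_subsequence by blast
    define w where "w = fst l"
    define b where "b = snd l"
    have w: "(\<lambda>k. Z (s k)) \<longlonglongrightarrow> w" and b: "(\<lambda>k. A (s k)) \<longlonglongrightarrow> b"
      using tendsto_fst[OF s(2)] tendsto_snd[OF s(2)] by (simp_all add: o_def w_def b_def)
    have Aw: "A m \<bullet> w \<le> 0" for m
    proof (rule LIMSEQ_le)
      show "(\<lambda>k. A m \<bullet> Z (s k)) \<longlonglongrightarrow> A m \<bullet> w" by (intro tendsto_intros w)
      show "(\<lambda>k. (A m \<bullet> (Y m - p) + \<bar>c\<bar>) / \<alpha> ^ s k) \<longlonglongrightarrow> 0"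
        using LIMSEQ_subseq_LIMSEQ[OF pow0 s(1)] by (simp add: o_def)
      have "A m \<bullet> Z k \<le> (A m \<bullet> (Y m - p) + \<bar>c\<bar>) / \<alpha> ^ k" for k
      proof -
        have "c * (A m \<bullet> A k) \<le> \<bar>c\<bar>"
        proof -
          have "\<bar>A m \<bullet> A k\<bar> \<le> 1" using Cauchy_Schwarz_ineq2[of "A m" "A k"] nA by simp
          then have "\<bar>c\<bar> * \<bar>A m \<bullet> A k\<bar> \<le> \<bar>c\<bar> * 1" by (intro mult_left_mono) auto
          then show ?thesis by (simp flip: abs_mult)
        qed
        moreover have "A m \<bullet> Y k = A m \<bullet> p + \<alpha> ^ k * (A m \<bullet> Z k) - c * (A m \<bullet> A k)"
          by (simp add: Y_def inner_add_right inner_diff_right)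
        ultimately have "\<alpha> ^ k * (A m \<bullet> Z k) \<le> A m \<bullet> (Y m - p) + \<bar>c\<bar>"
          using le[of m k] by (simp add: inner_diff_right)
        then show ?thesis using \<alpha> by (simp add: le_divide_eq mult.commute)
      qed
      then show "\<exists>N. \<forall>k\<ge>N. A m \<bullet> Z (s k) \<le> (A m \<bullet> (Y m - p) + \<bar>c\<bar>) / \<alpha> ^ s k" by blast
    qed
    have "(\<lambda>k. A (s k) \<bullet> Z (s k)) \<longlonglongrightarrow> b \<bullet> w" by (intro tendsto_intros w b)
    then have "b \<bullet> w = a \<bullet> z" by (simp add: AZ LIMSEQ_const_iff)
    moreover have "b \<bullet> w \<le> 0"
    proof (rule LIMSEQ_le_const2)
      show "(\<lambda>k. A (s k) \<bullet> w) \<longlonglongrightarrow> b \<bullet> w" by (intro tendsto_intros b)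
    qed (use Aw in blast)
    ultimately show ?thesis by simp
  qed
  ultimately have "a \<bullet> z = 0" by simp
  moreover have "a \<bullet> z = a \<bullet> (y - p) + c"
    using AA[of 0] by (simp add: z_def A_def inner_add_right)
  ultimately show ?thesis by (simp add: c_def inner_diff_right)
qed

section \<open>The characterization\<close>

theorem theorem3p1:
  fixes X :: "(real ^ 'n) set"
  assumes "convex_body X"
    and nondegenerate: "X = {} \<or> interior X \<noteq> {}"
  shows "(\<exists>r>0. \<exists>\<sigma>. distance_increasing_similarity \<sigma> \<and> erosion r X = \<sigma> ` X)
     \<longleftrightarrow> has_exscribed_ball X"
proof
  have X: "closed X" "convex X" using assms(1) by (auto simp: convex_body_def)
  {
    assume "\<exists>r>0. \<exists>\<sigma>. distance_increasing_similarity \<sigma> \<and> erosion r X = \<sigma> ` X"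
    then obtain r \<sigma> \<alpha> where r: "r > 0" "erosion r X = \<sigma> ` X"
      and \<alpha>: "\<alpha> > 1" "similarity \<alpha> \<sigma>"
      unfolding distance_increasing_similarity_def by blast
    obtain p T where T: "orthogonal_transformation T" "\<And>x. \<sigma> x = p + \<alpha> *\<^sub>R T (x - p)"
      using distance_increasing_similarity_fixpoint_form[OF \<alpha>(2,1)] by metis
    have "exscribed_ball X p (r / (\<alpha> - 1))"
      unfolding exscribed_ball_iff
      using regular_normal_height[OF X r(1) \<alpha>(1) T r(2)] r \<alpha> by simp
    then show "has_exscribed_ball X" unfolding has_exscribed_ball_def by blast
  next
    assume "has_exscribed_ball X"
    then obtain p \<rho> where ex: "exscribed_ball X p \<rho>" unfolding has_exscribed_ball_def by blast
    then have \<rho>: "\<rho> > 0" by (simp add: exscribed_ball_def)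
    define \<sigma> where "\<sigma> x = p + 2 *\<^sub>R (x - p)" for x
    have "dist (\<sigma> x) (\<sigma> y) = 2 * dist x y" for x y
    proof -
      have "\<sigma> x - \<sigma> y = 2 *\<^sub>R (x - y)" by (simp add: \<sigma>_def algebra_simps)
      then show ?thesis by (simp add: dist_norm)
    qed
    then have "distance_increasing_similarity \<sigma>"
      unfolding distance_increasing_similarity_def similarity_def by (intro exI[of _ 2]) simp
    moreover have "erosion \<rho> X = \<sigma> ` X"
    proof (cases "X = {}")
      case True
      then show ?thesis by (simp add: erosion_def)
    next
      case False
      then show ?thesis
        using exscribed_ball_imp_erosion_homothetic[OF X _ ex] nondegenerate
        by (simp add: \<sigma>_def[abs_def])
    qed
    ultimately show "\<exists>r>0. \<exists>\<sigma>. distance_increasing_similarity \<sigma> \<and> erosion r X = \<sigma> ` X"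
      using \<rho> by blast
  }
qed

end
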